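(* Let $f(-,\Theta,\mathbf{R})$ be a graph rule based layer and let $x\in\mathbb{R}^{|V|}$ be the input signal corresponding to a graph $G=(V,E)$. Then for every permutation $\pi$ of the node order of $G$ (permutation of the entries of $x$) it holds that $$f(\pi(x),\Theta,\mathbf{R})=\pi(f(x,\Theta,\mathbf{R})),$$ i.e. $f$ is permutation equivariant. Here $f(x,\Theta,\mathbf{R})$ is computed with the rule functions of $G$ and $f(\pi(x),\Theta,\mathbf{R})$ with the rule functions of the graph obtained from $G$ by reordering its nodes according to $\pi$.
   Context: Graphs are finite, undirected, without self-loops or parallel edges; the nodes are indexed as $V=[n]=\{1,\dots,n\}$ in some order, and an input signal is a vector $x\in\mathbb{R}^{|V|}$, one entry per node. Graph rules. Each graph comes with a node labeling function $l:V\to\mathcal{L}\subseteq\mathbb{N}$ and a property function $p:V\times V\to\{0\}\cup\mathbb{N}$ (e.g. the distance between two nodes); let $\mathcal{D}\subseteq\{0\}\cup\mathbb{N}$ be the set of valid values of $p$. Put $t(i,j)=(l(i),l(j),p(i,j))$. Given learnable real parameters $\Theta=\{w_1,\dots,w_N,b_1,\dots,b_M\}$, the graph rule $\mathbf{R}$ has rule functions $\mathbf{R}_W:V\times V\to\{0\}\cup[N]$ and $\mathbf{R}_b:V\to\{0\}\cup[M]$ such that: $\mathbf{R}_W(i,j)=0$ if $p(i,j)\notin\mathcal{D}$; for pairs with property value in $\mathcal{D}$, $\mathbf{R}_W(i,j)=\mathbf{R}_W(k,k')$ (a nonzero index) if and only if $t(i,j)=t(k,k')$; and $\mathbf{R}_b(i)=\mathbf{R}_b(j)$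 if and only if $l(i)=l(j)$. The index assigned is a fixed function of the triple $t(i,j)$ (respectively of the label $l(i)$), the same for all graphs. The graph rule based layer is $f(x,\Theta,\mathbf{R})=\sigma(W\cdot x+b)$ with $\sigma$ an activation function applied entrywise, $W\in\mathbb{R}^{n\times n}$ having $(i,j)$ entry $0$ if $\mathbf{R}_W(i,j)=0$ and $w_{\mathbf{R}_W(i,j)}$ otherwise, and $b\in\mathbb{R}^n$ having $i$-th entry $0$ if $\mathbf{R}_b(i)=0$ and $b_{\mathbf{R}_b(i)}$ otherwise. Reordering. For a permutation $\pi$ of $[n]$, $\pi(x)$ is the vector with $\pi(x)_{\pi(i)}=x_i$. The reordered graph has node $\pi(i)$ in place of $i$, edges $\{\pi(i),\pi(j)\}$ for $\{i,j\}\in E$, labeling function $l'$ with $l'(\pi(i))=l(i)$ and property function $p'$ with $p'(\pi(i),\pi(j))=p(i,j)$. *)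

theory Defs
  imports "Jordan_Normal_Form.Matrix" "HOL-Combinatorics.Permutations"
begin

text \<open>Nodes are numbered from \<open>0\<close> to \<open>n - 1\<close>, matching the indices of \<^typ>\<open>real vec\<close>.
  Labelling and property function are only meaningful on nodes.\<close>

record lgraph =
  num_nodes :: nat
  edges :: "nat set set"
  label :: "nat \<Rightarrow> nat"
  property :: "nat \<Rightarrow> nat \<Rightarrow> nat"

definition nodes :: "lgraph \<Rightarrow> nat set" where
  "nodes G = {..<num_nodes G}"

definition simple_graph :: "lgraph \<Rightarrow> bool" where
  "simple_graph G \<longleftrightarrow> (\<forall>e\<in>edges G. e \<subseteq> nodes G \<and> card e = 2)"

definition triple :: "lgraph \<Rightarrow> nat \<Rightarrow> nat \<Rightarrow> nat \<times> nat \<times> nat" where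
  "triple G i j = (label G i, label G j, property G i j)"

definition reorder :: "(nat \<Rightarrow> nat) \<Rightarrow> lgraph \<Rightarrow> lgraph" where
  "reorder \<pi> G = \<lparr>num_nodes = num_nodes G,
     edges = (\<lambda>e. \<pi> ` e) ` edges G,
     label = (\<lambda>i. label G (Hilbert_Choice.inv \<pi> i)),
     property = (\<lambda>i j. property G (Hilbert_Choice.inv \<pi> i) (Hilbert_Choice.inv \<pi> j))\<rparr>"

definition permute_signal :: "(nat \<Rightarrow> nat) \<Rightarrow> real vec \<Rightarrow> real vec" where
  "permute_signal \<pi> x = vec (dim_vec x) (\<lambda>i. x $ Hilbert_Choice.inv \<pi> i)"

lemma reorder_apply:
  assumes "\<pi> permutes nodes G"
  shows "label (reorder \<pi> G) (\<pi> i) = label G i"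
    and "property (reorder \<pi> G) (\<pi> i) (\<pi> j) = property G i j"
  using permutes_inverses(2)[OF assms] by (simp_all add: reorder_def)

lemma permute_signal_apply:
  assumes "\<pi> permutes {..<dim_vec x}" and "i < dim_vec x"
  shows "permute_signal \<pi> x $ \<pi> i = x $ i"
  using permutes_inverses(2)[OF assms(1)] permutes_in_image[OF assms(1), of i] assms(2)
  by (simp add: permute_signal_def)

text \<open>The rule functions depend on the graph. Their values are indices of parameters, numbered
  from 1, with \<open>0\<close> standing for the absence of a parameter.\<close>

record rule =
  label_set :: "nat set"
  valid_props :: "nat set"
  num_weights :: nat
  num_biases :: nat
  rule_W :: "lgraph \<Rightarrow> nat \<Rightarrow> nat \<Rightarrow> nat"
  rule_b :: "lgraph \<Rightarrow> nat \<Rightarrow> nat"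

text \<open>\<open>\<G>\<close> is the class of graphs to which the rule is applied. It is kept arbitrary, rather than
  being all graphs with labels in \<open>label_set R\<close>, because the finitely many parameters need only
  separate the triples occurring within each graph considered. It is closed under reordering
  since the order of the nodes is arbitrary.\<close>

locale graph_rule =
  fixes \<G> :: "lgraph set" and R :: rule
  assumes label_set_pos: "0 \<notin> label_set R"
    and simple: "G \<in> \<G> \<Longrightarrow> simple_graph G"
    and labels: "\<lbrakk>G \<in> \<G>; i \<in> nodes G\<rbrakk> \<Longrightarrow> label G i \<in> label_set R"
    and reorder_closed: "\<lbrakk>G \<in> \<G>; \<pi> permutes nodes G\<rbrakk> \<Longrightarrow> reorder \<pi> G \<in> \<G>"
    and rule_W_invalid:
      "\<lbrakk>G \<in> \<G>; i \<in> nodes G; j \<in> nodes G; property G i j \<notin> valid_props R\<rbrakk> \<Longrightarrow> rule_W R G i j = 0"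
    and rule_W_valid:
      "\<lbrakk>G \<in> \<G>; i \<in> nodes G; j \<in> nodes G; property G i j \<in> valid_props R\<rbrakk>
        \<Longrightarrow> rule_W R G i j \<in> {1..num_weights R}"
    and rule_W_eq_iff:
      "\<lbrakk>G \<in> \<G>; i \<in> nodes G; j \<in> nodes G; k \<in> nodes G; k' \<in> nodes G;
        property G i j \<in> valid_props R; property G k k' \<in> valid_props R\<rbrakk>
        \<Longrightarrow> rule_W R G i j = rule_W R G k k' \<longleftrightarrow> triple G i j = triple G k k'"
    and rule_b_range: "\<lbrakk>G \<in> \<G>; i \<in> nodes G\<rbrakk> \<Longrightarrow> rule_b R G i \<in> {0..num_biases R}"
    and rule_b_eq_iff:
      "\<lbrakk>G \<in> \<G>; i \<in> nodes G; j \<in> nodes G\<rbrakk>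
        \<Longrightarrow> rule_b R G i = rule_b R G j \<longleftrightarrow> label G i = label G j"
    and rule_W_uniform:
      "\<exists>\<phi>. \<forall>G\<in>\<G>. \<forall>i\<in>nodes G. \<forall>j\<in>nodes G.
        property G i j \<in> valid_props R \<longrightarrow> rule_W R G i j = \<phi> (triple G i j)"
    and rule_b_uniform:
      "\<exists>\<psi>. \<forall>G\<in>\<G>. \<forall>i\<in>nodes G. rule_b R G i = \<psi> (label G i)"

text \<open>Only the weights \<open>1..num_weights R\<close> and the biases \<open>1..num_biases R\<close> are ever used.\<close>

record params =
  weight :: "nat \<Rightarrow> real"
  bias :: "nat \<Rightarrow> real"

definition weight_mat :: "params \<Rightarrow> rule \<Rightarrow> lgraph \<Rightarrow> real mat" where
  "weight_mat \<Theta> R G = mat (num_nodes G) (num_nodes G)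
     (\<lambda>(i, j). if rule_W R G i j = 0 then 0 else weight \<Theta> (rule_W R G i j))"

definition bias_vec :: "params \<Rightarrow> rule \<Rightarrow> lgraph \<Rightarrow> real vec" where
  "bias_vec \<Theta> R G = vec (num_nodes G)
     (\<lambda>i. if rule_b R G i = 0 then 0 else bias \<Theta> (rule_b R G i))"

definition layer ::
  "(real \<Rightarrow> real) \<Rightarrow> lgraph \<Rightarrow> real vec \<Rightarrow> params \<Rightarrow> rule \<Rightarrow> real vec" where
  "layer \<sigma> G x \<Theta> R = map_vec \<sigma> (weight_mat \<Theta> R G *\<^sub>v x + bias_vec \<Theta> R G)"

end

theory Submission imports Defs begin

text \<open>The rule functions see a node only through its label and its properties with respect to
  other nodes, and reordering transports these along \<open>\<pi>\<close>. Hence the weight matrix and the bias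
  of the reordered graph are those of \<open>G\<close> with their indices pulled back along \<open>\<pi>\<inverse>\<close>, and the matrix
  product is unaffected, as \<open>\<pi>\<inverse>\<close> merely permutes its summands.\<close>

lemma num_nodes_reorder [simp]: "num_nodes (reorder \<pi> G) = num_nodes G"
  by (simp add: reorder_def)

lemma nodes_reorder [simp]: "nodes (reorder \<pi> G) = nodes G"
  by (simp add: nodes_def)

lemma label_reorder [simp]: "label (reorder \<pi> G) i = label G (Hilbert_Choice.inv \<pi> i)"
  by (simp add: reorder_def)

lemma property_reorder [simp]:
  "property (reorder \<pi> G) i j = property G (Hilbert_Choice.inv \<pi> i) (Hilbert_Choice.inv \<pi> j)"
  by (simp add: reorder_def)

lemma triple_reorder [simp]: "triple (reorder \<pi> G) i j = triple G (Hilbert_Choice.inv \<pi> i) (Hilbert_Choice.inv \<pi> j)"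
  by (simp add: triple_def)

context graph_rule
begin

text \<open>Indices of two different graphs are compared, so the argument rests on a single \<phi>
  serving all of \<open>\<G>\<close>, which contains the reordered graph by
  \<open>reorder_closed\<close>. Both pairs have the same triple.\<close>

lemma rule_W_reorder:
  assumes G: "G \<in> \<G>" and \<pi>: "\<pi> permutes nodes G" and i: "i \<in> nodes G" and j: "j \<in> nodes G"
  shows "rule_W R (reorder \<pi> G) i j = rule_W R G (Hilbert_Choice.inv \<pi> i) (Hilbert_Choice.inv \<pi> j)"
proof -
  have G': "reorder \<pi> G \<in> \<G>"
    using reorder_closed G \<pi> .
  have inv_nodes: "Hilbert_Choice.inv \<pi> i \<in> nodes G" "Hilbert_Choice.inv \<pi> j \<in> nodes G"
    using i j permutes_in_image[OF permutes_inv[OF \<pi>]] by simp_all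
  show ?thesis
  proof (cases "property G (Hilbert_Choice.inv \<pi> i) (Hilbert_Choice.inv \<pi> j) \<in> valid_props R")
    case True
    obtain \<phi> where "\<forall>G\<in>\<G>. \<forall>i\<in>nodes G. \<forall>j\<in>nodes G.
        property G i j \<in> valid_props R \<longrightarrow> rule_W R G i j = \<phi> (triple G i j)"
      using rule_W_uniform ..
    then show ?thesis
      using True G G' i j inv_nodes by simp
  next
    \<comment> \<open>Both pairs share this invalid property value, so both indices are
      \<open>0\<close>.\<close>
    case False
    then show ?thesis
      using rule_W_invalid[OF G] rule_W_invalid[OF G'] i j inv_nodes by simp
  qed
qed

lemma rule_b_reorder:
  assumes G: "G \<in> \<G>" and \<pi>: "\<pi> permutes nodes G" and i: "i \<in> nodes G"
  shows "rule_b R (reorder \<pi> G) i = rule_b R G (Hilbert_Choice.inv \<pi> i)"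
proof -
  obtain \<psi> where "\<forall>G\<in>\<G>. \<forall>i\<in>nodes G. rule_b R G i = \<psi> (label G i)"
    using rule_b_uniform ..
  then show ?thesis
    using reorder_closed[OF G \<pi>] G i permutes_in_image[OF permutes_inv[OF \<pi>]] by simp
qed

text \<open>Since the inverse of \<pi> maps nodes to nodes, the entries on both sides lie within the
  bounds where \<open>mat\<close> is specified.\<close>

lemma weight_mat_reorder_index:
  assumes "G \<in> \<G>" and \<pi>: "\<pi> permutes nodes G" and "i < num_nodes G" and "j < num_nodes G"
  shows "weight_mat \<Theta> R (reorder \<pi> G) $$ (i, j) = weight_mat \<Theta> R G $$ (Hilbert_Choice.inv \<pi> i, Hilbert_Choice.inv \<pi> j)"
  using assms permutes_in_image[OF permutes_inv[OF \<pi>]] rule_W_reorder[OF assms(1,2)]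
  by (simp add: weight_mat_def nodes_def)

lemma bias_vec_reorder_index:
  assumes "G \<in> \<G>" and \<pi>: "\<pi> permutes nodes G" and "i < num_nodes G"
  shows "bias_vec \<Theta> R (reorder \<pi> G) $ i = bias_vec \<Theta> R G $ Hilbert_Choice.inv \<pi> i"
  using assms permutes_in_image[OF permutes_inv[OF \<pi>]] rule_b_reorder[OF assms(1,2)]
  by (simp add: bias_vec_def nodes_def)

end

lemma dim_layer [simp]: "dim_vec (layer \<sigma> G x \<Theta> R) = num_nodes G"
  by (simp add: layer_def bias_vec_def)

text \<open>The carrier assumption matters because \<open>scalar_prod\<close> sums up to the
  dimension of its second argument. The range \<open>{..<num_nodes G}\<close> is the set that \<pi>
  permutes, ready for reindexing.\<close>

lemma layer_index:
  assumes "i < num_nodes G" and "x \<in> carrier_vec (num_nodes G)"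
  shows "layer \<sigma> G x \<Theta> R $ i =
    \<sigma> ((\<Sum>j<num_nodes G. weight_mat \<Theta> R G $$ (i, j) * x $ j) + bias_vec \<Theta> R G $ i)"
  using assms
  by (simp add: layer_def weight_mat_def bias_vec_def scalar_prod_def atLeast0LessThan)

theorem proposition3:
  fixes \<sigma> :: "real \<Rightarrow> real" and \<Theta> :: params and R :: rule and \<G> :: "lgraph set"
    and G :: lgraph and x :: "real vec" and \<pi> :: "nat \<Rightarrow> nat"
  assumes "graph_rule \<G> R"
    and "G \<in> \<G>"
    and "x \<in> carrier_vec (num_nodes G)"
    and "\<pi> permutes nodes G"
  shows "layer \<sigma> (reorder \<pi> G) (permute_signal \<pi> x) \<Theta> R = permute_signal \<pi> (layer \<sigma> G x \<Theta> R)"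
proof (rule eq_vecI)
  interpret graph_rule \<G> R by fact
  let ?W = "weight_mat \<Theta> R" and ?b = "bias_vec \<Theta> R" and ?n = "num_nodes G"
  have inv_perm: "Hilbert_Choice.inv \<pi> permutes {..<?n}"
    using permutes_inv[OF assms(4)] by (simp add: nodes_def)
  have dim_x: "dim_vec x = ?n"
    using assms(3) by (rule carrier_vecD)
  then have x': "permute_signal \<pi> x \<in> carrier_vec (num_nodes (reorder \<pi> G))"
    by (intro carrier_vecI) (simp add: permute_signal_def)
  fix i
  assume "i < dim_vec (permute_signal \<pi> (layer \<sigma> G x \<Theta> R))"
  then have i: "i < ?n"
    by (simp add: permute_signal_def)
  then have inv_i: "Hilbert_Choice.inv \<pi> i < ?n"
    using permutes_in_image[OF inv_perm] by simp
  have "(\<Sum>j<?n. ?W (reorder \<pi> G) $$ (i, j) * permute_signal \<pi> x $ j) =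
      (\<Sum>j<?n. ?W G $$ (Hilbert_Choice.inv \<pi> i, Hilbert_Choice.inv \<pi> j) * x $ Hilbert_Choice.inv \<pi> j)"
    using i dim_x by (intro sum.cong)
      (simp_all add: weight_mat_reorder_index[OF assms(2,4)] permute_signal_def)
  \<comment> \<open>Only the summation index is substituted; the row stays fixed.\<close>
  also have "\<dots> = (\<Sum>j<?n. ?W G $$ (Hilbert_Choice.inv \<pi> i, j) * x $ j)"
    using sum.permute[OF inv_perm, of "\<lambda>j. ?W G $$ (Hilbert_Choice.inv \<pi> i, j) * x $ j"] by (simp add: o_def)
  finally have "layer \<sigma> (reorder \<pi> G) (permute_signal \<pi> x) \<Theta> R $ i = layer \<sigma> G x \<Theta> R $ Hilbert_Choice.inv \<pi> i"
    using i by (simp add: layer_index[OF _ x'] layer_index[OF inv_i assms(3)]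
        bias_vec_reorder_index[OF assms(2,4)])
  then show "layer \<sigma> (reorder \<pi> G) (permute_signal \<pi> x) \<Theta> R $ i =
      permute_signal \<pi> (layer \<sigma> G x \<Theta> R) $ i"
    using i by (simp add: permute_signal_def)
\<comment> \<open>What remains from \<open>eq_vecI\<close> is that the dimensions agree.\<close>
qed (simp add: permute_signal_def)

end
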